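(* Let $W$ be a real symmetric positive definite $n\times n$ matrix, let $k\in\{1,\dots,n\}$, and let $W_{1:k,1:k}=R^TR$ be the Cholesky decomposition of the leading $k\times k$ principal submatrix of $W$, with $R$ upper triangular with positive diagonal. Define $(\bar d,\bar\alpha)\in\mathbb{R}^n_{++}\times\mathbb{R}^{k(k-1)/2}$ by $$\bar d_j = R_{j,j}^{-1}\ \text{ for } 1\le j\le k,\qquad \bar d_j = W_{j,j}^{-1/2}\ \text{ for } k+1\le j\le n,$$ $$\bar\alpha_{i,j} = -\frac{1}{R_{i,i}}\left(\sum_{s=i+1}^{j-1}R_{i,s}\,\bar\alpha_{s,j} + R_{i,j}\,\bar d_j\right)\quad\text{for } k\ge j>i\ge 1$$ (for each $j$ computed recursively for $i=j-1,j-2,\dots,1$). Then $(\bar d,\bar\alpha)$ gives the $\omega$-optimal incomplete upper triangular preconditioner for $W$, i.e. $$(\bar d,\bar\alpha)\in\operatorname*{argmin}_{(d,\alpha)\in\mathbb{R}^n_{++}\times\mathbb{R}^{k(k-1)/2}} \ \omega\left(D_{+tk}(d,\alpha)^T\, W\, D_{+tk}(d,\alpha)\right),$$ and $D_{+tk}(\bar d,\bar\alpha)=\operatorname{blkdiag}\left(R^{-1},\operatorname{Diag}(\bar d_{k+1},\dots,\bar d_n)\right)$.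
   Context: For a real symmetric positive definite $n\times n$ matrix $M$, $\omega(M)=\dfrac{\operatorname{trace}(M)/n}{\det(M)^{1/n}}$. $\mathbb{R}^n_{++}$ is the set of vectors with all entries positive. For $d\in\mathbb{R}^n$ and $\alpha=(\alpha_{i,j})_{1\le i<j\le k}\in\mathbb{R}^{k(k-1)/2}$, $D_{+tk}(d,\alpha)$ is the $n\times n$ upper triangular matrix whose diagonal is $d$, whose $(i,j)$ entry is $\alpha_{i,j}$ for $1\le i<j\le k$, and whose other entries are $0$. $\operatorname{Diag}$ denotes the diagonal matrix with given diagonal and $\operatorname{blkdiag}$ the block diagonal matrix with given diagonal blocks. *)

theory Defs
  imports Complex_Main "HOL-Library.FuncSet" "Jordan_Normal_Form.Determinant"
begin

text \<open>
  Vectors and matrices are those of \<^theory>\<open>Jordan_Normal_Form.Matrix\<close>, hence indexed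
  from \<open>0\<close>: the mathematical index ranges \<open>1..k\<close> and \<open>k+1..n\<close> become \<open>j < k\<close> and
  \<open>k \<le> j < n\<close>.
\<close>

definition sym_pos_def :: "nat \<Rightarrow> real mat \<Rightarrow> bool" where
  "sym_pos_def n M \<longleftrightarrow> M \<in> carrier_mat n n \<and> transpose_mat M = M \<and>
     (\<forall>v \<in> carrier_vec n. v \<noteq> 0\<^sub>v n \<longrightarrow> v \<bullet> (M *\<^sub>v v) > 0)"

definition trace :: "real mat \<Rightarrow> real" where
  "trace M = (\<Sum>i<dim_row M. M $$ (i, i))"

text \<open>Only meaningful for symmetric positive definite matrices of size at least \<open>1\<close>.\<close>

definition omega :: "real mat \<Rightarrow> real" where
  "omega M = (trace M / real (dim_row M)) / root (dim_row M) (det M)"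

definition leading_submatrix :: "nat \<Rightarrow> real mat \<Rightarrow> real mat" where
  "leading_submatrix k W = mat k k (\<lambda>(i, j). W $$ (i, j))"

definition cholesky_factor :: "nat \<Rightarrow> real mat \<Rightarrow> real mat \<Rightarrow> bool" where
  "cholesky_factor k A R \<longleftrightarrow> R \<in> carrier_mat k k \<and> upper_triangular R \<and>
     (\<forall>i<k. R $$ (i, i) > 0) \<and> A = transpose_mat R * R"

definition pos_vecs :: "nat \<Rightarrow> real vec set" where
  "pos_vecs n = {d \<in> carrier_vec n. \<forall>i<n. d $ i > 0}"

definition strict_pairs :: "nat \<Rightarrow> (nat \<times> nat) set" where
  "strict_pairs k = {(i, j). i < j \<and> j < k}"

text \<open>
  The space of dimension \<open>k(k-1)/2\<close> of parameters \<open>\<alpha>\<close>, as real families indexed by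
  \<^term>\<open>strict_pairs k\<close>.
\<close>

definition alpha_space :: "nat \<Rightarrow> (nat \<times> nat \<Rightarrow> real) set" where
  "alpha_space k = strict_pairs k \<rightarrow>\<^sub>E UNIV"

definition D_tk :: "nat \<Rightarrow> real vec \<Rightarrow> (nat \<times> nat \<Rightarrow> real) \<Rightarrow> real mat" where
  "D_tk k d \<alpha> = mat (dim_vec d) (dim_vec d)
     (\<lambda>(i, j). if i = j then d $ i else if (i, j) \<in> strict_pairs k then \<alpha> (i, j) else 0)"

definition d_bar :: "nat \<Rightarrow> real mat \<Rightarrow> real mat \<Rightarrow> real vec" where
  "d_bar k W R = vec (dim_row W)
     (\<lambda>j. if j < k then inverse (R $$ (j, j)) else W $$ (j, j) powr (- 1 / 2))"

text \<open>
  The recursion descends in \<open>i\<close> for fixed \<open>j\<close>. Its values are only used for \<open>i < j < k\<close>.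
\<close>

function alpha_rec :: "real mat \<Rightarrow> real vec \<Rightarrow> nat \<Rightarrow> nat \<Rightarrow> real" where
  "alpha_rec R d i j =
     - (1 / R $$ (i, i)) *
       ((\<Sum>s\<in>{i<..<j}. R $$ (i, s) * alpha_rec R d s j) + R $$ (i, j) * d $ j)"
  by pat_completeness auto
termination
  by (relation "measure (\<lambda>(R, d, i, j). j - i)") auto

declare alpha_rec.simps [simp del]

definition alpha_bar :: "nat \<Rightarrow> real mat \<Rightarrow> real mat \<Rightarrow> nat \<times> nat \<Rightarrow> real" where
  "alpha_bar k W R = restrict (\<lambda>(i, j). alpha_rec R (d_bar k W R) i j) (strict_pairs k)"

end

theory Submission
  imports Defs "HOL-Analysis.Convex"
begin

text \<open>
  Write \<open>D = D_tk k d \<alpha>\<close>, let \<open>C\<close> be its leading block of size \<open>k\<close>, and put \<open>r j = R $$ (j, j)\<close> for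
  \<open>j < k\<close> and \<open>r j = sqrt (W $$ (j, j))\<close> for \<open>k \<le> j\<close>. A column of \<open>D\<close> with index \<open>j < k\<close> lives in the
  first \<open>k\<close> coordinates, where \<open>W\<close> acts as \<open>transpose_mat R * R\<close>, so it contributes the squared norm
  of column \<open>j\<close> of \<open>R * C\<close> to the trace of \<open>transpose_mat D * W * D\<close>. Dropping the entries of \<open>R * C\<close>
  off the diagonal leaves \<open>(r j * d j)\<^sup>2\<close>, and the columns beyond \<open>k\<close> contribute exactly that. Hence the
  trace is at least the sum of the \<open>(r j * d j)\<^sup>2\<close> (lemma \<open>trace_congruence_ge\<close>).

  By the inequality between the arithmetic and the geometric mean, the numerator of \<open>omega\<close> is at
  least the \<open>n\<close>-th root of the product of the \<open>(r j)\<^sup>2\<close> times that of the \<open>(d j)\<^sup>2\<close>. The determinant is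
  \<open>det W\<close> times the product of the \<open>(d j)\<^sup>2\<close>, so \<open>d\<close> cancels and \<open>omega\<close> is at least the constant
  \<open>root n ((\<Prod>j<n. (r j)\<^sup>2) / det W)\<close> (lemma \<open>omega_congruence_ge\<close>).

  Equality holds as soon as \<open>R * C\<close> is the identity and \<open>r j * d j = 1\<close> for all \<open>j\<close> (lemma
  \<open>omega_congruence_eq\<close>). The recursion for \<open>alpha_bar\<close> is back substitution for the equation
  \<open>R * C = 1\<^sub>m k\<close> (lemma \<open>cholesky_times_block\<close>), and \<open>d_bar\<close> is the reciprocal of \<open>r\<close>; this gives both
  the minimality and the block diagonal form.
\<close>

section \<open>Positive definite matrices\<close>

text \<open>
  The segment from the identity to \<open>M\<close> consists of positive definite, hence nonsingular, matrices.
  The determinant is continuous along it and equal to \<open>1\<close> at its start, so it cannot change sign.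
\<close>

lemma sym_pos_def_det_pos:
  assumes M: "sym_pos_def n M"
  shows "det M > 0"
proof (rule ccontr)
  assume neg: "\<not> det M > 0"
  have cM: "M \<in> carrier_mat n n" using M by (simp add: sym_pos_def_def)
  define S :: "real \<Rightarrow> real mat" where
    "S t = t \<cdot>\<^sub>m M + (1 - t) \<cdot>\<^sub>m 1\<^sub>m n" for t
  have cS: "S t \<in> carrier_mat n n" for t using cM by (simp add: S_def)
  have entry: "S t $$ (i, j) = t * M $$ (i, j) + (1 - t) * 1\<^sub>m n $$ (i, j)"
    if "i < n" "j < n" for t i j
    using that cM by (simp add: S_def)
  have "continuous_on {0..1} (\<lambda>t. \<Sum>p | p permutes {0..<n}.
      signof p * (\<Prod>i = 0..<n. t * M $$ (i, p i) + (1 - t) * 1\<^sub>m n $$ (i, p i)))"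
    by (intro continuous_intros)
  moreover have det_S: "det (S t) = (\<Sum>p | p permutes {0..<n}.
      signof p * (\<Prod>i = 0..<n. t * M $$ (i, p i) + (1 - t) * 1\<^sub>m n $$ (i, p i)))" for t
    unfolding det_def'[OF cS]
    by (intro sum.cong refl arg_cong2[where f = "(*)"] prod.cong entry)
       (auto dest: permutes_in_image)
  ultimately have cont: "continuous_on {0..1} (\<lambda>t. det (S t))" by simp
  have "S 0 = 1\<^sub>m n" "S 1 = M" using cM by (auto simp: S_def)
  then have "det (S 0) = 1" "det (S 1) \<le> 0" using neg by auto
  then obtain t where t: "0 \<le> t" "t \<le> 1" "det (S t) = 0"
    using IVT2'[of "\<lambda>t. det (S t)" 1 0 0] cont by auto
  then obtain v where v: "v \<in> carrier_vec n" "v \<noteq> 0\<^sub>v n" and Sv: "S t *\<^sub>v v = 0\<^sub>v n"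
    using det_0_iff_vec_prod_zero[OF cS] by auto
  have smult: "(c \<cdot>\<^sub>m A) *\<^sub>v v = c \<cdot>\<^sub>v (A *\<^sub>v v)"
    if "A \<in> carrier_mat n n" for c :: real and A
    using that v(1) by (intro eq_vecI) auto
  have "0 = v \<bullet> (S t *\<^sub>v v)" using Sv v(1) by simp
  also have "S t *\<^sub>v v = t \<cdot>\<^sub>v (M *\<^sub>v v) + (1 - t) \<cdot>\<^sub>v v"
    using cM v(1)
    by (simp add: S_def add_mult_distrib_mat_vec[of _ n n] smult)
  also have "v \<bullet> (t \<cdot>\<^sub>v (M *\<^sub>v v) + (1 - t) \<cdot>\<^sub>v v) = t * (v \<bullet> (M *\<^sub>v v)) + (1 - t) * (v \<bullet> v)"
    using cM v(1) by (simp add: scalar_prod_add_distrib[of _ n])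
  finally have zero: "0 = t * (v \<bullet> (M *\<^sub>v v)) + (1 - t) * (v \<bullet> v)" .
  have Mv: "v \<bullet> (M *\<^sub>v v) > 0" using M v by (auto simp: sym_pos_def_def)
  have vv: "v \<bullet> v > 0"
  proof -
    have "v \<bullet> v = (\<Sum>i = 0..<n. (v $ i)\<^sup>2)"
      using v(1) by (simp add: scalar_prod_def power2_eq_square)
    moreover obtain i where "i < n" "v $ i \<noteq> 0" using v by (auto simp: vec_eq_iff)
    ultimately show ?thesis by (auto intro!: sum_pos2[of _ i])
  qed
  have "t * (v \<bullet> (M *\<^sub>v v)) + (1 - t) * (v \<bullet> v) > 0"
  proof (cases "t = 0")
    case False
    then have "t * (v \<bullet> (M *\<^sub>v v)) > 0" "(1 - t) * (v \<bullet> v) \<ge> 0" using t(1,2) Mv vv by auto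
    then show ?thesis by linarith
  qed (use vv in simp)
  then show False using zero by simp
qed

lemma congruence_entry:
  fixes A M :: "'a :: comm_ring_1 mat"
  assumes "A \<in> carrier_mat n n" "M \<in> carrier_mat n n" "i < n" "j < n"
  shows "(transpose_mat A * M * A) $$ (i, j)
    = (\<Sum>q<n. \<Sum>p<n. A $$ (p, i) * M $$ (p, q) * A $$ (q, j))"
  using assms
  by (simp add: scalar_prod_def sum_distrib_right lessThan_atLeast0 del: assoc_mult_mat)

lemma sym_pos_def_diagonal_pos:
  assumes M: "sym_pos_def n M" and j: "j < n"
  shows "M $$ (j, j) > 0"
proof -
  have cM: "M \<in> carrier_mat n n" using M by (simp add: sym_pos_def_def)
  have "unit_vec n j \<noteq> (0\<^sub>v n :: real vec)"
    using j by (metis index_unit_vec(1) index_zero_vec(1) zero_neq_one)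
  then have "0 < unit_vec n j \<bullet> (M *\<^sub>v unit_vec n j)"
    using M by (auto simp: sym_pos_def_def)
  then show ?thesis using cM j by simp
qed

section \<open>The trace of the preconditioned matrix\<close>

lemma D_tk_carrier: "d \<in> carrier_vec n \<Longrightarrow> D_tk k d \<alpha> \<in> carrier_mat n n"
  by (auto simp: D_tk_def)

lemma det_D_tk:
  assumes "d \<in> carrier_vec n"
  shows "det (D_tk k d \<alpha>) = (\<Prod>j<n. d $ j)"
proof -
  have "upper_triangular (D_tk k d \<alpha>)"
    by (auto simp: D_tk_def strict_pairs_def)
  from det_upper_triangular[OF this D_tk_carrier[OF assms]] assms show ?thesis
    by (simp add: prod_list_diag_prod D_tk_def lessThan_atLeast0)
qed

lemma det_congruence_D_tk:
  assumes W: "W \<in> carrier_mat n n" and d: "d \<in> carrier_vec n"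
  shows "det (transpose_mat (D_tk k d \<alpha>) * W * D_tk k d \<alpha>) = det W * (\<Prod>j<n. (d $ j)\<^sup>2)"
  using D_tk_carrier[OF d, of k \<alpha>] W
  by (simp add: det_mult[of _ n] det_transpose det_D_tk[OF d] power2_eq_square prod.distrib
      del: assoc_mult_mat)

lemma leading_block_entry:
  assumes W: "leading_submatrix k W = transpose_mat R * R" and R: "R \<in> carrier_mat k k"
    and "p < k" "q < k"
  shows "W $$ (p, q) = (\<Sum>s<k. R $$ (s, p) * R $$ (s, q))"
proof -
  have "W $$ (p, q) = leading_submatrix k W $$ (p, q)"
    using assms(3,4) by (simp add: leading_submatrix_def)
  then show ?thesis using assms by (simp add: scalar_prod_def lessThan_atLeast0)
qed

text \<open>
  Column \<open>j\<close> of \<open>D\<close> vanishes in the rows from \<open>k\<close> on, so the quadratic form only sees the leading block of \<open>W\<close>;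
  its factorisation by \<open>R\<close> turns the form into the squared norm of a column.
\<close>

lemma congruence_diagonal_leading:
  assumes W: "W \<in> carrier_mat n n" and kn: "k \<le> n" and d: "d \<in> carrier_vec n"
    and R: "cholesky_factor k (leading_submatrix k W) R" and j: "j < k"
  shows "(transpose_mat (D_tk k d \<alpha>) * W * D_tk k d \<alpha>) $$ (j, j)
    = (\<Sum>s<k. ((R * leading_submatrix k (D_tk k d \<alpha>)) $$ (s, j))\<^sup>2)"
proof -
  let ?D = "D_tk k d \<alpha>"
  have cR: "R \<in> carrier_mat k k" and WR: "leading_submatrix k W = transpose_mat R * R"
    using R by (auto simp: cholesky_factor_def)
  have zero: "?D $$ (p, j) = 0" if "p \<in> {..<n} - {..<k}" for p
    using that d j kn by (auto simp: D_tk_def strict_pairs_def)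
  have RC: "(R * leading_submatrix k ?D) $$ (s, j) = (\<Sum>p<k. R $$ (s, p) * ?D $$ (p, j))"
    if "s < k" for s
    using that j cR by (simp add: leading_submatrix_def scalar_prod_def lessThan_atLeast0)
  have "(transpose_mat ?D * W * ?D) $$ (j, j)
      = (\<Sum>q<n. \<Sum>p<n. ?D $$ (p, j) * W $$ (p, q) * ?D $$ (q, j))"
    using congruence_entry[OF D_tk_carrier[OF d] W] j kn by simp
  also have "\<dots> = (\<Sum>q<k. \<Sum>p<n. ?D $$ (p, j) * W $$ (p, q) * ?D $$ (q, j))"
    using kn zero by (intro sum.mono_neutral_right) auto
  also have "\<dots> = (\<Sum>q<k. \<Sum>p<k. ?D $$ (p, j) * W $$ (p, q) * ?D $$ (q, j))"
    using kn zero by (intro sum.cong refl sum.mono_neutral_right) auto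
  also have "\<dots> = (\<Sum>q<k. \<Sum>p<k. \<Sum>s<k.
      (R $$ (s, p) * ?D $$ (p, j)) * (R $$ (s, q) * ?D $$ (q, j)))"
    by (intro sum.cong refl)
       (simp add: leading_block_entry[OF WR cR] sum_distrib_left sum_distrib_right mult_ac)
  also have "\<dots> = (\<Sum>q<k. \<Sum>s<k. \<Sum>p<k.
      (R $$ (s, p) * ?D $$ (p, j)) * (R $$ (s, q) * ?D $$ (q, j)))"
    by (intro sum.cong refl sum.swap)
  also have "\<dots> = (\<Sum>s<k. \<Sum>q<k. \<Sum>p<k.
      (R $$ (s, p) * ?D $$ (p, j)) * (R $$ (s, q) * ?D $$ (q, j)))"
    by (rule sum.swap)
  also have "\<dots> = (\<Sum>s<k. ((R * leading_submatrix k ?D) $$ (s, j))\<^sup>2)"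
    by (intro sum.cong refl)
       (simp add: RC power2_eq_square sum_distrib_left sum_distrib_right)
  finally show ?thesis .
qed

lemma congruence_diagonal_trailing:
  assumes W: "W \<in> carrier_mat n n" and d: "d \<in> carrier_vec n" and j: "k \<le> j" "j < n"
  shows "(transpose_mat (D_tk k d \<alpha>) * W * D_tk k d \<alpha>) $$ (j, j) = W $$ (j, j) * (d $ j)\<^sup>2"
proof -
  have col: "D_tk k d \<alpha> $$ (p, j) = (if p = j then d $ j else 0)" if "p < n" for p
    using that d j by (auto simp: D_tk_def strict_pairs_def)
  have "(transpose_mat (D_tk k d \<alpha>) * W * D_tk k d \<alpha>) $$ (j, j)
      = (\<Sum>q<n. \<Sum>p<n. (if p = j then d $ j else 0) * W $$ (p, q) * (if q = j then d $ j else 0))"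
    using congruence_entry[OF D_tk_carrier[OF d] W] j(2) by (simp add: col)
  also have "\<dots> = (\<Sum>q<n. \<Sum>p<n.
      if p = j then if q = j then d $ j * W $$ (j, j) * d $ j else 0 else 0)"
    by (intro sum.cong refl) simp
  also have "\<dots> = W $$ (j, j) * (d $ j)\<^sup>2"
    using j(2) by (simp add: power2_eq_square)
  finally show ?thesis .
qed

text \<open>
  The reciprocals of the optimal scaling factors: the diagonal of the matrix that agrees with \<open>R\<close> on
  the leading block and with the Cholesky factor of the diagonal of \<open>W\<close> beyond it.
\<close>

definition pivot :: "nat \<Rightarrow> real mat \<Rightarrow> real mat \<Rightarrow> nat \<Rightarrow> real" where
  "pivot k W R j = (if j < k then R $$ (j, j) else sqrt (W $$ (j, j)))"

lemma pivot_pos: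
  assumes "sym_pos_def n W" "cholesky_factor k (leading_submatrix k W) R" "j < n"
  shows "pivot k W R j > 0"
  using assms sym_pos_def_diagonal_pos by (auto simp: pivot_def cholesky_factor_def)

lemma d_bar_eq_inverse_pivot:
  assumes W: "sym_pos_def n W" and j: "j < n"
  shows "d_bar k W R $ j = inverse (pivot k W R j)"
proof -
  have "W $$ (j, j) powr (- 1 / 2) = inverse (sqrt (W $$ (j, j)))"
    using sym_pos_def_diagonal_pos[OF W j] by (simp add: powr_minus powr_half_sqrt)
  then show ?thesis
    using W j by (auto simp: d_bar_def pivot_def sym_pos_def_def)
qed

text \<open>
  Both \<open>R\<close> and the leading block are upper triangular, so the diagonal of their product is the product
  of their diagonals. Keeping only these entries of \<open>R * C\<close> gives the bound.
\<close>

lemma trace_congruence_ge: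
  assumes W: "sym_pos_def n W" and kn: "k \<le> n" and d: "d \<in> carrier_vec n"
    and R: "cholesky_factor k (leading_submatrix k W) R"
  shows "(\<Sum>j<n. (pivot k W R j * d $ j)\<^sup>2) \<le> trace (transpose_mat (D_tk k d \<alpha>) * W * D_tk k d \<alpha>)"
proof -
  let ?D = "D_tk k d \<alpha>"
  have cW: "W \<in> carrier_mat n n" using W by (simp add: sym_pos_def_def)
  have cR: "R \<in> carrier_mat k k" and uR: "upper_triangular R"
    using R by (auto simp: cholesky_factor_def)
  have "(pivot k W R j * d $ j)\<^sup>2 \<le> (transpose_mat ?D * W * ?D) $$ (j, j)" if j: "j < n" for j
  proof (cases "j < k")
    case True
    have "(R * leading_submatrix k ?D) $$ (j, j) = (\<Sum>p<k. R $$ (j, p) * ?D $$ (p, j))"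
      using True cR by (simp add: leading_submatrix_def scalar_prod_def lessThan_atLeast0)
    also have "\<dots> = (\<Sum>p<k. if p = j then R $$ (j, j) * d $ j else 0)"
    proof (intro sum.cong refl)
      fix p assume "p \<in> {..<k}"
      then show "R $$ (j, p) * ?D $$ (p, j) = (if p = j then R $$ (j, j) * d $ j else 0)"
        using True d kn cR upper_triangularD[OF uR, of p j]
        by (cases p j rule: linorder_cases) (auto simp: D_tk_def strict_pairs_def)
    qed
    also have "\<dots> = pivot k W R j * d $ j" using True by (simp add: pivot_def)
    finally have "(pivot k W R j * d $ j)\<^sup>2 = ((R * leading_submatrix k ?D) $$ (j, j))\<^sup>2" by simp
    also have "\<dots> \<le> (\<Sum>s<k. ((R * leading_submatrix k ?D) $$ (s, j))\<^sup>2)"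
      using True by (intro member_le_sum) auto
    finally show ?thesis
      by (simp add: congruence_diagonal_leading[OF cW kn d R True])
  next
    case False
    then show ?thesis
      using sym_pos_def_diagonal_pos[OF W j] j congruence_diagonal_trailing[OF cW d, of k j \<alpha>]
      by (simp add: pivot_def power_mult_distrib)
  qed
  then show ?thesis
    using D_tk_carrier[OF d, of k \<alpha>] unfolding trace_def by (auto intro: sum_mono)
qed

section \<open>The optimal value of omega\<close>

text \<open>
  The arithmetic-geometric mean inequality is applied to the lower bounds \<open>(r j * d j)\<^sup>2\<close> and not to the
  diagonal itself: the product of these bounds is proportional to the determinant, with a factor
  independent of \<open>d\<close> and \<open>\<alpha>\<close>.
\<close>

lemma omega_congruence_ge:
  assumes W: "sym_pos_def n W" and n: "1 \<le> n" and kn: "k \<le> n" and d: "d \<in> pos_vecs n"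
    and R: "cholesky_factor k (leading_submatrix k W) R"
  shows "root n ((\<Prod>j<n. (pivot k W R j)\<^sup>2) / det W)
    \<le> omega (transpose_mat (D_tk k d \<alpha>) * W * D_tk k d \<alpha>)"
proof -
  let ?M = "transpose_mat (D_tk k d \<alpha>) * W * D_tk k d \<alpha>"
  let ?x = "\<lambda>j. (pivot k W R j * d $ j)\<^sup>2"
  have cW: "W \<in> carrier_mat n n" using W by (simp add: sym_pos_def_def)
  have cd: "d \<in> carrier_vec n" and dpos: "\<And>j. j < n \<Longrightarrow> d $ j > 0"
    using d by (auto simp: pos_vecs_def)
  have dimM: "dim_row ?M = n" using D_tk_carrier[OF cd, of k \<alpha>] by simp
  have prod_d: "0 < (\<Prod>j<n. (d $ j)\<^sup>2)"
    using dpos by (intro prod_pos) (simp add: less_imp_neq[symmetric])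
  then have detM: "det ?M > 0"
    using sym_pos_def_det_pos[OF W] by (simp add: det_congruence_D_tk[OF cW cd])
  have prod_x: "0 < (\<Prod>j<n. ?x j)"
    using pivot_pos[OF W R] dpos by (intro prod_pos) (simp add: less_imp_neq[symmetric])
  have "root n (\<Prod>j<n. ?x j) = (\<Prod>j<n. ?x j) powr (1 / card {..<n})"
    using prod_x n by (simp add: root_powr_inverse)
  also have "\<dots> \<le> (\<Sum>j<n. ?x j / card {..<n})"
    using n by (intro arith_geom_mean) (auto simp: lessThan_empty_iff)
  also have "\<dots> = (\<Sum>j<n. ?x j) / n"
    by (simp add: sum_divide_distrib)
  also have "\<dots> \<le> trace ?M / n"
    using trace_congruence_ge[OF W kn cd R] by (simp add: divide_right_mono)
  finally have "root n (\<Prod>j<n. ?x j) / root n (det ?M) \<le> omega ?M"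
    using detM n unfolding omega_def dimM by (intro divide_right_mono) auto
  moreover have "(\<Prod>j<n. ?x j) / det ?M = (\<Prod>j<n. (pivot k W R j)\<^sup>2) / det W"
    using less_imp_neq[OF prod_d]
    by (simp add: det_congruence_D_tk[OF cW cd] power_mult_distrib prod.distrib del: prod_zero_iff)
  ultimately show ?thesis by (simp flip: real_root_divide)
qed

text \<open>
  Under these hypotheses every diagonal entry of the preconditioned matrix is \<open>1\<close>, so the arithmetic
  mean in the numerator of \<open>omega\<close> is \<open>1\<close> and only the determinant remains.
\<close>

lemma omega_congruence_eq:
  assumes W: "sym_pos_def n W" and n: "1 \<le> n" and kn: "k \<le> n" and d: "d \<in> carrier_vec n"
    and R: "cholesky_factor k (leading_submatrix k W) R"
    and RC: "R * leading_submatrix k (D_tk k d \<alpha>) = 1\<^sub>m k"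
    and inv: "\<And>j. j < n \<Longrightarrow> d $ j = inverse (pivot k W R j)"
  shows "omega (transpose_mat (D_tk k d \<alpha>) * W * D_tk k d \<alpha>)
    = root n ((\<Prod>j<n. (pivot k W R j)\<^sup>2) / det W)"
proof -
  let ?M = "transpose_mat (D_tk k d \<alpha>) * W * D_tk k d \<alpha>"
  have cW: "W \<in> carrier_mat n n" using W by (simp add: sym_pos_def_def)
  have dimM: "dim_row ?M = n" using D_tk_carrier[OF d, of k \<alpha>] by simp
  have "?M $$ (j, j) = 1" if j: "j < n" for j
  proof (cases "j < k")
    case True
    have "(\<Sum>s<k. (1\<^sub>m k $$ (s, j))\<^sup>2) = (\<Sum>s<k. if s = j then 1 else (0 :: real))"
      using True by (intro sum.cong) auto
    then show ?thesis
      using True by (simp add: congruence_diagonal_leading[OF cW kn d R True] RC)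
  next
    case False
    then show ?thesis
      using sym_pos_def_diagonal_pos[OF W j] j inv[OF j]
        congruence_diagonal_trailing[OF cW d, of k j \<alpha>]
      by (simp add: pivot_def power_inverse)
  qed
  then have "trace ?M = n" unfolding trace_def dimM by simp
  moreover have "(\<Prod>j<n. (d $ j)\<^sup>2) = inverse (\<Prod>j<n. (pivot k W R j)\<^sup>2)"
    using prod_inversef[of "\<lambda>j. (pivot k W R j)\<^sup>2" "{..<n}"] by (simp add: inv power_inverse o_def)
  then have "det ?M = inverse ((\<Prod>j<n. (pivot k W R j)\<^sup>2) / det W)"
    unfolding det_congruence_D_tk[OF cW d] by (simp add: field_simps)
  ultimately show ?thesis
    using n unfolding omega_def dimM by (simp add: real_root_divide)
qed

section \<open>Back substitution\<close>

text \<open>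
  In column \<open>j\<close> the entry of \<open>R * C\<close> at row \<open>i < j\<close> is
  \<open>R $$ (i, i) * \<alpha> (i, j) + (\<Sum>s\<in>{i<..<j}. R $$ (i, s) * \<alpha> (s, j)) + R $$ (i, j) * d $ j\<close>, and the
  recursion chooses \<open>\<alpha> (i, j)\<close> so that it vanishes.
\<close>

lemma cholesky_times_block:
  assumes W: "W \<in> carrier_mat n n" and kn: "k \<le> n"
    and R: "cholesky_factor k (leading_submatrix k W) R"
  shows "R * leading_submatrix k (D_tk k (d_bar k W R) (alpha_bar k W R)) = 1\<^sub>m k"
proof (rule eq_matI)
  let ?d = "d_bar k W R" and ?\<alpha> = "alpha_bar k W R"
  let ?D = "D_tk k ?d ?\<alpha>"
  have cR: "R \<in> carrier_mat k k" and uR: "upper_triangular R"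
    and Rpos: "\<And>i. i < k \<Longrightarrow> R $$ (i, i) > 0"
    using R by (auto simp: cholesky_factor_def)
  have d: "dim_vec ?d = n" using W by (simp add: d_bar_def)
  have D: "?D $$ (p, q) = (if p = q then ?d $ p else if p < q then alpha_rec R ?d p q else 0)"
    if "p < k" "q < k" for p q
    using that d kn by (auto simp: D_tk_def strict_pairs_def alpha_bar_def)
  show "(R * leading_submatrix k ?D) $$ (i, j) = 1\<^sub>m k $$ (i, j)"
    if "i < dim_row (1\<^sub>m k :: real mat)" "j < dim_col (1\<^sub>m k :: real mat)" for i j
  proof -
    have ij: "i < k" "j < k" using that by auto
    have dj: "?d $ j = inverse (R $$ (j, j))" using ij(2) kn W by (simp add: d_bar_def)
    let ?f = "\<lambda>p. R $$ (i, p) * ?D $$ (p, j)"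
    have "(R * leading_submatrix k ?D) $$ (i, j) = (\<Sum>p<k. ?f p)"
      using ij cR by (simp add: leading_submatrix_def scalar_prod_def lessThan_atLeast0)
    also have "\<dots> = (\<Sum>p\<in>{i..j}. ?f p)"
      using ij cR upper_triangularD[OF uR]
      by (intro sum.mono_neutral_right) (auto simp: D not_le)
    also have "\<dots> = 1\<^sub>m k $$ (i, j)"
    proof (cases i j rule: linorder_cases)
      case less
      then have "{i..j} = insert i (insert j {i<..<j})" by auto
      then have "(\<Sum>p\<in>{i..j}. ?f p) = ?f i + (?f j + (\<Sum>p\<in>{i<..<j}. ?f p))"
        using less by simp
      moreover have "(\<Sum>p\<in>{i<..<j}. ?f p) = (\<Sum>s\<in>{i<..<j}. R $$ (i, s) * alpha_rec R ?d s j)"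
        using ij by (intro sum.cong) (auto simp: D)
      moreover have "R $$ (i, i) * alpha_rec R ?d i j =
          - ((\<Sum>s\<in>{i<..<j}. R $$ (i, s) * alpha_rec R ?d s j) + R $$ (i, j) * ?d $ j)"
        using Rpos[OF ij(1)] by (subst alpha_rec.simps) (simp add: field_simps)
      ultimately show ?thesis using less ij by (simp add: D)
    next
      case equal
      then show ?thesis
        using ij Rpos[OF ij(1)] by (simp add: D dj)
    next
      case greater
      then show ?thesis using ij by simp
    qed
    finally show ?thesis .
  qed
qed (use R in \<open>auto simp: cholesky_factor_def leading_submatrix_def\<close>)

lemma D_tk_block_diagonal:
  assumes d: "d \<in> carrier_vec n" and kn: "k \<le> n"
  shows "D_tk k d \<alpha> =
    diag_block_mat [leading_submatrix k (D_tk k d \<alpha>), mat_diag (n - k) (\<lambda>i. d $ (k + i))]"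
  by (rule eq_matI)
     (use d kn in \<open>auto simp: D_tk_def strict_pairs_def leading_submatrix_def mat_diag_def\<close>)

section \<open>The optimal incomplete upper triangular preconditioner\<close>

theorem theorem2p7:
  fixes W R :: "real mat" and n k :: nat
  assumes "sym_pos_def n W"
    and "1 \<le> k" and "k \<le> n"
    and "cholesky_factor k (leading_submatrix k W) R"
  shows "is_arg_min
           (\<lambda>(d, \<alpha>). omega (transpose_mat (D_tk k d \<alpha>) * W * D_tk k d \<alpha>))
           (\<lambda>(d, \<alpha>). (d, \<alpha>) \<in> pos_vecs n \<times> alpha_space k)
           (d_bar k W R, alpha_bar k W R)
       \<and> (\<exists>Rinv \<in> carrier_mat k k. inverts_mat R Rinv \<and> inverts_mat Rinv R \<and>
            D_tk k (d_bar k W R) (alpha_bar k W R) =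
              diag_block_mat [Rinv, mat_diag (n - k) (\<lambda>i. d_bar k W R $ (k + i))])"
proof
  let ?d = "d_bar k W R" and ?\<alpha> = "alpha_bar k W R"
  let ?C = "leading_submatrix k (D_tk k ?d ?\<alpha>)"
  note W = assms(1) and kn = assms(3) and R = assms(4)
  have n: "1 \<le> n" using assms(2,3) by simp
  have cW: "W \<in> carrier_mat n n" using W by (simp add: sym_pos_def_def)
  have cR: "R \<in> carrier_mat k k" using R by (simp add: cholesky_factor_def)
  have cd: "?d \<in> carrier_vec n" using cW by (auto simp: d_bar_def)
  have cC: "?C \<in> carrier_mat k k" by (simp add: leading_submatrix_def)
  have RC: "R * ?C = 1\<^sub>m k" by (rule cholesky_times_block[OF cW kn R])

  have "?d \<in> pos_vecs n"
    using cd pivot_pos[OF W R] by (simp add: pos_vecs_def d_bar_eq_inverse_pivot[OF W])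
  moreover have "?\<alpha> \<in> alpha_space k"
    by (simp add: alpha_bar_def alpha_space_def)
  moreover have "omega (transpose_mat (D_tk k ?d ?\<alpha>) * W * D_tk k ?d ?\<alpha>)
      \<le> omega (transpose_mat (D_tk k d \<alpha>) * W * D_tk k d \<alpha>)" if "d \<in> pos_vecs n" for d \<alpha>
    using omega_congruence_ge[OF W n kn that R]
      omega_congruence_eq[OF W n kn cd R RC d_bar_eq_inverse_pivot[OF W]] by simp
  ultimately show "is_arg_min
           (\<lambda>(d, \<alpha>). omega (transpose_mat (D_tk k d \<alpha>) * W * D_tk k d \<alpha>))
           (\<lambda>(d, \<alpha>). (d, \<alpha>) \<in> pos_vecs n \<times> alpha_space k) (?d, ?\<alpha>)"
    by (auto simp: is_arg_min_linorder)

  have "inverts_mat R ?C" "inverts_mat ?C R"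
    using RC mat_mult_left_right_inverse[OF cR cC RC] cR cC by (auto simp: inverts_mat_def)
  then show "\<exists>Rinv \<in> carrier_mat k k. inverts_mat R Rinv \<and> inverts_mat Rinv R \<and>
      D_tk k ?d ?\<alpha> = diag_block_mat [Rinv, mat_diag (n - k) (\<lambda>i. ?d $ (k + i))]"
    using cC D_tk_block_diagonal[OF cd kn] by blast
qed

end
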